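(* Let $c,\delta\in\mathbb{R}$ and let $p_\delta(c)$ be the asymptotic $\delta$-record probability in the linear drift model $Y_n=X_n+cn$ with underlying cdf $F$ and pdf $f$. Then $p_\delta(c)>0$ if and only if $\mu^+<\infty$ and one of the following conditions holds: (i) $c>0$ and $\delta<x_+-x_-+c$; (ii) $c=0$, $\delta<0$ and $x_+<\infty$.
   Context: Linear drift model: $Y_n=X_n+cn$, $n\ge1$, where $c\in\mathbb{R}$ and $(X_n)_{n\ge1}$ are iid real random variables with absolutely continuous cdf $F$ and pdf $f$. It is assumed that there are $-\infty\le x_-<x_+\le\infty$ such that $f(x)>0$ for all $x\in(x_-,x_+)$ and $f(x)=0$ otherwise; so $x_-=\inf\{x:F(x)>0\}$ and $x_+=\sup\{x:F(x)<1\}$ ($x_+-x_-=\infty$ if either endpoint is infinite). Put $\mu^+=\int_0^\infty xf(x)\,dx\in[0,\infty]$. For $\delta\in\mathbb{R}$, $Y_1$ is by convention a $\delta$-record, and for $j\ge2$, $Y_j$ is a $\delta$-record if $Y_j>\max\{Y_1,\dots,Y_{j-1}\}+\delta$. The probability that $Y_j$ is a $\delta$-record is $p_{j,\delta}(c)=\int_{-\infty}^\infty\prod_{i=1}^{j-1}F(x+ci-\delta)f(x)\,dx$, and the asymptotic $\delta$-record probability is $$p_\delta(c)=\lim_{n\to\infty}p_{n,\delta}(c)=\int_{-\infty}^\infty\prod_{i=1}^{\infty}F(x+ci-\delta)f(x)\,dx,$$ where the infinite product is the limit of the nonincreasing partial products. *)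

theory Defs
  imports "HOL-Probability.Probability"
begin

text \<open>
  The underlying iid sequence is indexed from 1; \<open>X 0\<close> plays no role.  The endpoints of the
  support are extended reals, and \<open>f\<close> vanishes at the endpoints themselves.
\<close>

locale linear_drift_model = prob_space M
  for M :: "'a measure" +
  fixes X :: "nat \<Rightarrow> 'a \<Rightarrow> real"
    and f :: "real \<Rightarrow> real"
    and x_minus x_plus :: ereal
  assumes indep: "indep_vars (\<lambda>_. borel) X {1..}"
    and density: "\<And>n. n \<ge> 1 \<Longrightarrow> distributed M lborel (X n) (\<lambda>x. ennreal (f x))"
    and endpoints: "x_minus < x_plus"
    and f_pos: "\<And>x. x_minus < ereal x \<Longrightarrow> ereal x < x_plus \<Longrightarrow> f x > 0"
    and f_zero: "\<And>x. \<not> (x_minus < ereal x \<and> ereal x < x_plus) \<Longrightarrow> f x = 0"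

definition drift :: "(nat \<Rightarrow> 'a \<Rightarrow> real) \<Rightarrow> real \<Rightarrow> nat \<Rightarrow> 'a \<Rightarrow> real" where
  "drift X c n \<omega> = X n \<omega> + c * real n"

definition delta_record :: "real \<Rightarrow> (nat \<Rightarrow> real) \<Rightarrow> nat \<Rightarrow> bool" where
  "delta_record \<delta> y j \<longleftrightarrow> j = 1 \<or> (j \<ge> 2 \<and> y j > Max (y ` {1..j - 1}) + \<delta>)"

definition record_prob ::
  "'a measure \<Rightarrow> (nat \<Rightarrow> 'a \<Rightarrow> real) \<Rightarrow> nat \<Rightarrow> real \<Rightarrow> real \<Rightarrow> real" where
  "record_prob M X j \<delta> c =
     measure M {\<omega> \<in> space M. delta_record \<delta> (\<lambda>n. drift X c n \<omega>) j}"

text \<open>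
  In the model, for \<open>j \<ge> 1\<close>, \<open>record_prob M X j \<delta> c\<close> is the integral of
  \<open>(\<Prod>i=1..j-1. F (x + c * i - \<delta>)) * f x\<close>, with \<open>F\<close> the cdf of \<open>X 1\<close>, which is nonincreasing
  in \<open>j\<close>; so the limit below exists.
\<close>

definition asymp_record_prob ::
  "'a measure \<Rightarrow> (nat \<Rightarrow> 'a \<Rightarrow> real) \<Rightarrow> real \<Rightarrow> real \<Rightarrow> real" where
  "asymp_record_prob M X \<delta> c = lim (\<lambda>n. record_prob M X n \<delta> c)"

definition mu_plus :: "(real \<Rightarrow> real) \<Rightarrow> ennreal" where
  "mu_plus f = (\<integral>\<^sup>+ x \<in> {0..}. ennreal (x * f x) \<partial>lborel)"

end

theory Submission
  imports Defs
begin

text \<open>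
  Conditioning on the last variable turns the record probability into the integral of
  \<open>F(x + c - \<delta>) \<cdots> F(x + cn - \<delta>)\<close> against the law. The integrand is monotone in \<open>x\<close>, so
  the limit is positive iff the infinite product is positive at some \<open>x\<close> in the support, that is,
  iff all factors are positive there and \<open>1 - F(x + ck - \<delta>)\<close> is summable in \<open>k\<close>. For \<open>c > 0\<close>
  summability is the finiteness of \<open>\<mu>\<^sup>+\<close> and only the first factor can vanish; for \<open>c = 0\<close> the
  factors must equal 1, and for \<open>c < 0\<close> they tend to 0.
\<close>

section \<open>Infinite products with factors in [0,1]\<close>

lemma decseq_prod_lessThan:
  fixes a :: "nat \<Rightarrow> real"
  assumes "\<And>k. 0 \<le> a k" "\<And>k. a k \<le> 1"
  shows "decseq (\<lambda>n. \<Prod>k<n. a k)"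
  unfolding decseq_Suc_iff using assms by (auto intro!: mult_right_le_one_le prod_nonneg)

text \<open>The partial products decrease to some \<open>L\<close>. If \<open>L\<close> were
  positive, \<open>1 + t \<le> exp t\<close> would bound every partial sum of \<open>1 - a k\<close>
  by \<open>- ln L\<close>.\<close>

lemma prod_tendsto_0_if_not_summable:
  fixes a :: "nat \<Rightarrow> real"
  assumes a: "\<And>k. 0 \<le> a k" "\<And>k. a k \<le> 1"
    and ns: "\<not> summable (\<lambda>k. 1 - a k)"
  shows "(\<lambda>n. \<Prod>k<n. a k) \<longlonglongrightarrow> 0"
proof -
  have dec: "decseq (\<lambda>n. \<Prod>k<n. a k)"
    using a by (rule decseq_prod_lessThan)
  have nn: "0 \<le> (\<Prod>k<n. a k)" for n
    using a by (auto intro!: prod_nonneg)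
  obtain L where L: "(\<lambda>n. \<Prod>k<n. a k) \<longlonglongrightarrow> L" "\<And>n. L \<le> (\<Prod>k<n. a k)"
    using decseq_convergent[OF dec, of 0] nn by blast
  have "L \<ge> 0"
    using L(1) nn by (intro LIMSEQ_le_const) auto
  moreover have "\<not> L > 0"
  proof
    assume "L > 0"
    have "(\<Sum>k<n. 1 - a k) \<le> - ln L" for n
    proof -
      have "L \<le> (\<Prod>k<n. a k)" by (rule L)
      also have "\<dots> \<le> (\<Prod>k<n. exp (- (1 - a k)))"
        using a exp_ge_add_one_self[of "- (1 - a k)" for k] by (intro prod_mono) (auto simp: algebra_simps)
      also have "\<dots> = exp (- (\<Sum>k<n. 1 - a k))"
        by (simp add: exp_sum sum_negf[symmetric])
      finally have "ln L \<le> - (\<Sum>k<n. 1 - a k)"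
        using \<open>L > 0\<close> by (metis exp_gt_zero ln_exp ln_le_cancel_iff)
      then show ?thesis by linarith
    qed
    then have "summable (\<lambda>k. 1 - a k)"
      using a by (intro summableI_nonneg_bounded[where x = "- ln L"]) auto
    with ns show False ..
  qed
  ultimately show ?thesis using L(1) by (simp add: order_le_less)
qed

text \<open>An absolutely convergent product of positive factors has a positive limit, and the
  decreasing partial products never fall below it; the limit itself serves as
  \<open>e\<close>.\<close>

lemma prod_bounded_below_if_summable:
  fixes a :: "nat \<Rightarrow> real"
  assumes a: "\<And>k. 0 < a k" "\<And>k. a k \<le> 1"
    and s: "summable (\<lambda>k. 1 - a k)"
  obtains e where "e > 0" "\<And>n. e \<le> (\<Prod>k<n. a k)"
proof -
  have "norm (a k - 1) = 1 - a k" for k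
    using a(2)[of k] by simp
  then have "summable (\<lambda>k. norm (a k - 1))"
    using s by simp
  then have cp: "convergent_prod a"
    by (intro abs_convergent_prod_imp_convergent_prod summable_imp_abs_convergent_prod)
  have dec: "decseq (\<lambda>n. \<Prod>k<n. a k)"
    using a by (intro decseq_prod_lessThan) (auto intro: less_imp_le)
  have lim: "(\<lambda>n. \<Prod>k<n. a k) \<longlonglongrightarrow> prodinf a"
    using convergent_prod_LIMSEQ[OF cp] by (simp add: LIMSEQ_lessThan_iff_atMost)
  show ?thesis
  proof
    show "prodinf a > 0"
      using cp a(1) by (rule less_0_prodinf)
    show "prodinf a \<le> (\<Prod>k<n. a k)" for n
      using decseq_ge[OF dec lim] .
  qed
qed

section \<open>The common law and its distribution function\<close>

context linear_drift_model
begin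

definition law :: "real measure" where
  "law = density lborel (\<lambda>x. ennreal (f x))"

text \<open>Strict version of the cdf; it agrees with the cdf because the law has no atoms.\<close>

definition F :: "real \<Rightarrow> real" where
  "F t = measure law {..<t}"

text \<open>The conditional probability that index \<open>Suc n\<close> is a record, given that its
  variable has the value \<open>x\<close>.\<close>

definition record_integrand :: "real \<Rightarrow> real \<Rightarrow> nat \<Rightarrow> real \<Rightarrow> real" where
  "record_integrand c \<delta> n x = (\<Prod>k<n. F (x + c * real (Suc k) - \<delta>))"

lemma f_measurable [measurable]: "(\<lambda>x. ennreal (f x)) \<in> borel_measurable borel"
  using density[of 1] by (auto simp: distributed_def)

lemma distr_eq_law: "n \<ge> 1 \<Longrightarrow> distr M borel (X n) = law"
  using density[of n] by (auto simp: distributed_def law_def cong: distr_cong)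

lemma X_measurable: "n \<ge> 1 \<Longrightarrow> X n \<in> borel_measurable M"
  using density[of n] by (auto simp: distributed_def)

lemma sets_law [measurable_cong, simp]: "sets law = sets borel"
  by (simp add: law_def)

lemma space_law [simp]: "space law = UNIV"
  by (simp add: law_def)

sublocale law: prob_space law
  using prob_space_distr[OF X_measurable[of 1]] distr_eq_law[of 1] by simp

lemma f_nonneg: "f x \<ge> 0"
  using f_pos[of x] f_zero[of x] by (cases "x_minus < ereal x \<and> ereal x < x_plus") auto

lemma AE_law_support: "AE x in law. x_minus < ereal x \<and> ereal x < x_plus"
proof -
  have "x_minus < ereal x \<and> ereal x < x_plus" if "0 < ennreal (f x)" for x
    using that f_zero[of x] by (cases "x_minus < ereal x \<and> ereal x < x_plus") auto
  then show ?thesis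
    unfolding law_def by (subst AE_density) auto
qed

text \<open>Since \<open>f\<close> is positive on the interval, a null set of the law there would
  also be Lebesgue null, which is impossible for \<open>u < v\<close>.\<close>

lemma law_interval_pos:
  assumes "u < v" "x_minus \<le> ereal u" "ereal v \<le> x_plus"
  shows "0 < measure law {u<..<v}"
proof (rule ccontr)
  assume "\<not> ?thesis"
  then have "emeasure law {u<..<v} = 0"
    by (simp add: law.emeasure_eq_measure not_less measure_le_0_iff)
  then have "AE x in law. x \<notin> {u<..<v}"
    by (intro AE_I[where N = "{u<..<v}"]) auto
  then have "AE x in lborel. 0 < ennreal (f x) \<longrightarrow> x \<notin> {u<..<v}"
    unfolding law_def by (subst (asm) AE_density) auto
  moreover have "0 < ennreal (f x)" if "x \<in> {u<..<v}" for x
    using that assms f_pos[of x] by (cases x_minus; cases x_plus) auto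
  ultimately have "AE x in lborel. x \<notin> {u<..<v}"
    by (auto elim: eventually_mono)
  then have "emeasure lborel {u<..<v} = 0"
    by (subst (asm) AE_iff_measurable[where N = "{u<..<v}"]) auto
  with assms show False by simp
qed

lemma F_mono: "s \<le> t \<Longrightarrow> F s \<le> F t"
  unfolding F_def by (intro law.finite_measure_mono) auto

lemma F_nonneg [simp]: "0 \<le> F t" and F_le_1 [simp]: "F t \<le> 1"
  unfolding F_def by auto

lemma F_measurable [measurable]: "F \<in> borel_measurable borel"
  by (rule borel_measurable_mono) (auto intro!: monoI F_mono)

lemma one_minus_F: "1 - F t = measure law {t..}"
proof -
  have "{t..} = UNIV - {..<t}" by auto
  then show ?thesis unfolding F_def using law.prob_compl[of "{..<t}"] by simp
qed

lemma law_greaterThan_pos: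
  assumes "ereal t < x_plus"
  shows "0 < measure law {t<..}"
proof -
  have "max x_minus (ereal t) < x_plus" using assms endpoints by simp
  then obtain u where u: "max x_minus (ereal t) < ereal u" "ereal u < x_plus"
    using ereal_dense2 by blast
  then obtain v where v: "ereal u < ereal v" "ereal v < x_plus"
    using ereal_dense2 by blast
  have "0 < measure law {u<..<v}"
    using u v by (intro law_interval_pos) auto
  also have "\<dots> \<le> measure law {t<..}"
    using u by (intro law.finite_measure_mono) auto
  finally show ?thesis .
qed

lemma F_pos_iff: "0 < F t \<longleftrightarrow> x_minus < ereal t"
proof
  assume "0 < F t"
  show "x_minus < ereal t"
  proof (rule ccontr)
    assume "\<not> x_minus < ereal t"
    then have "x \<notin> {..<t}" if "x_minus < ereal x" for x
      using that by (cases x_minus) auto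
    then have "AE x in law. x \<notin> {..<t}"
      by (intro eventually_mono[OF AE_law_support]) blast
    then have "F t = 0"
      unfolding F_def by (subst law.prob_eq_0) auto
    with \<open>0 < F t\<close> show False by simp
  qed
next
  assume "x_minus < ereal t"
  then have "x_minus < min x_plus (ereal t)" using endpoints by simp
  then obtain v where v: "x_minus < ereal v" "ereal v < min x_plus (ereal t)"
    using ereal_dense2 by blast
  then obtain u where u: "x_minus < ereal u" "ereal u < ereal v"
    using ereal_dense2 by blast
  have "0 < measure law {u<..<v}"
    using u v by (intro law_interval_pos) auto
  also have "\<dots> \<le> F t"
    unfolding F_def using v by (intro law.finite_measure_mono) auto
  finally show "0 < F t" .
qed

lemma F_eq_1_iff: "F t = 1 \<longleftrightarrow> x_plus \<le> ereal t"
proof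
  assume "F t = 1"
  then have "measure law {t..} = 0" using one_minus_F[of t] by simp
  moreover have "measure law {t<..} \<le> measure law {t..}"
    by (intro law.finite_measure_mono) auto
  ultimately show "x_plus \<le> ereal t"
    using law_greaterThan_pos[of t] by force
next
  assume "x_plus \<le> ereal t"
  then have "x \<in> {..<t}" if "ereal x < x_plus" for x
    using that by (cases x_plus) auto
  then have "AE x in law. x \<in> {..<t}"
    by (intro eventually_mono[OF AE_law_support]) blast
  then show "F t = 1"
    unfolding F_def by (subst law.prob_eq_1) auto
qed

section \<open>The record probability as an integral\<close>

lemma record_integrand_nonneg [simp]: "0 \<le> record_integrand c \<delta> n x"
  and record_integrand_le_1 [simp]: "record_integrand c \<delta> n x \<le> 1"
  unfolding record_integrand_def by (auto intro!: prod_nonneg prod_le_1)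

lemma record_integrand_measurable [measurable]:
  "record_integrand c \<delta> n \<in> borel_measurable borel"
  unfolding record_integrand_def by measurable

lemma integrable_record_integrand: "integrable law (record_integrand c \<delta> n)"
  by (rule law.integrable_const_bound[where B = 1]) auto

lemma distr_restrict_eq_PiM_law:
  assumes "I \<noteq> {}" "I \<subseteq> {1..}"
  shows "distr M (\<Pi>\<^sub>M i\<in>I. borel) (\<lambda>\<omega>. \<lambda>i\<in>I. X i \<omega>) = (\<Pi>\<^sub>M i\<in>I. law)"
proof -
  have "indep_vars (\<lambda>_. borel) X I"
    using indep assms(2) by (rule indep_vars_subset)
  then have "distr M (\<Pi>\<^sub>M i\<in>I. borel) (\<lambda>\<omega>. \<lambda>i\<in>I. X i \<omega>) = (\<Pi>\<^sub>M i\<in>I. distr M borel (X i))"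
    using assms X_measurable by (subst (asm) indep_vars_iff_distr_eq_PiM') auto
  also have "\<dots> = (\<Pi>\<^sub>M i\<in>I. law)"
    using assms distr_eq_law by (intro PiM_cong) auto
  finally show ?thesis .
qed

text \<open>Under the product law, fixing the last coordinate turns the record event into a box in
  the earlier coordinates, whose measure is a product of values of \<open>F\<close>. Tonelli then
  integrates over the last coordinate.\<close>

lemma record_prob_Suc:
  "record_prob M X (Suc n) \<delta> c = integral\<^sup>L law (record_integrand c \<delta> n)"
proof -
  let ?I = "{1..n}" and ?J = "insert (Suc n) {1..n}"
  let ?X = "\<lambda>\<omega>. \<lambda>i\<in>?J. X i \<omega>"
  define A where "A = {y \<in> space (\<Pi>\<^sub>M i\<in>?J. (borel :: real measure)).
    \<forall>i\<in>?I. y i + c * real i + \<delta> < y (Suc n) + c * real (Suc n)}"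
  interpret P: product_sigma_finite "\<lambda>_. law"
    by standard
  have J: "?J \<noteq> {}" "?J \<subseteq> {1..}" by auto
  have XP: "?X \<in> measurable M (\<Pi>\<^sub>M i\<in>?J. borel)"
    using X_measurable by (intro measurable_restrict) auto
  have comp: "(\<lambda>y. y i) \<in> borel_measurable (\<Pi>\<^sub>M i\<in>?J. (borel :: real measure))" if "i \<in> ?J" for i
    using that by (rule measurable_component_singleton)
  have A: "A \<in> sets (\<Pi>\<^sub>M i\<in>?J. borel)"
    unfolding A_def
    by (intro sets.sets_Collect_finite_All borel_measurable_less borel_measurable_add
        borel_measurable_const comp) auto
  have sPi: "sets (\<Pi>\<^sub>M i\<in>?J. law) = sets (\<Pi>\<^sub>M i\<in>?J. borel)"
    by (intro sets_PiM_cong) auto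
  \<comment> \<open>For \<open>n = 0\<close> the right side is vacuous, in agreement with the
    convention for the first index; only for \<open>n > 0\<close> is the maximum taken over a
    nonempty set.\<close>
  have rec: "delta_record \<delta> y (Suc n) \<longleftrightarrow> (\<forall>i\<in>?I. y i + \<delta> < y (Suc n))" for y
  proof (cases "n = 0")
    case False
    then have "Max (y ` ?I) < y (Suc n) - \<delta> \<longleftrightarrow> (\<forall>i\<in>?I. y i < y (Suc n) - \<delta>)"
      by (subst Max_less_iff) auto
    then show ?thesis using False by (auto simp: delta_record_def algebra_simps)
  qed (auto simp: delta_record_def)
  have "{\<omega> \<in> space M. delta_record \<delta> (\<lambda>m. drift X c m \<omega>) (Suc n)} = ?X -` A \<inter> space M"
    unfolding rec drift_def A_def by (auto simp: space_PiM)
  then have "emeasure M {\<omega> \<in> space M. delta_record \<delta> (\<lambda>m. drift X c m \<omega>) (Suc n)}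
      = emeasure (distr M (\<Pi>\<^sub>M i\<in>?J. borel) ?X) A"
    using emeasure_distr[OF XP A] by simp
  also have "\<dots> = emeasure (\<Pi>\<^sub>M i\<in>?J. law) A"
    unfolding distr_restrict_eq_PiM_law[OF J] ..
  also have "\<dots> = integral\<^sup>N (\<Pi>\<^sub>M i\<in>?J. law) (indicator A)"
    using A sPi by (subst nn_integral_indicator) auto
  also have "\<dots> = (\<integral>\<^sup>+x. (\<integral>\<^sup>+y. indicator A (y(Suc n := x)) \<partial>(\<Pi>\<^sub>M i\<in>?I. law)) \<partial>law)"
    using A sPi by (intro P.product_nn_integral_insert_rev) auto
  also have "\<dots> = (\<integral>\<^sup>+x. ennreal (record_integrand c \<delta> n x) \<partial>law)"
  proof (intro nn_integral_cong)
    fix x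
    \<comment> \<open>The record inequality against index \<open>i\<close>, solved for
      \<open>y i\<close>. Its strictness is why \<open>F\<close> is defined with an open
      half-line.\<close>
    let ?B = "\<lambda>i. {..< x + c * (real (Suc n) - real i) - \<delta>}"
    have "(\<integral>\<^sup>+y. indicator A (y(Suc n := x)) \<partial>(\<Pi>\<^sub>M i\<in>?I. law))
        = (\<integral>\<^sup>+y. indicator (Pi\<^sub>E ?I ?B) y \<partial>(\<Pi>\<^sub>M i\<in>?I. law))"
    proof (intro nn_integral_cong)
      fix y assume "y \<in> space (\<Pi>\<^sub>M i\<in>?I. law)"
      then have y: "y \<in> extensional ?I" by (simp add: space_PiM PiE_def)
      then have "y(Suc n := x) \<in> extensional ?J" by (auto simp: extensional_def)
      then have "y(Suc n := x) \<in> A \<longleftrightarrow> y \<in> Pi\<^sub>E ?I ?B"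
        using y unfolding A_def by (auto simp: space_PiM PiE_def Pi_def algebra_simps)
      then show "indicator A (y(Suc n := x)) = (indicator (Pi\<^sub>E ?I ?B) y :: ennreal)"
        by (simp add: indicator_def)
    qed
    also have "\<dots> = emeasure (\<Pi>\<^sub>M i\<in>?I. law) (Pi\<^sub>E ?I ?B)"
      by (intro nn_integral_indicator sets_PiM_I_finite) auto
    also have "\<dots> = (\<Prod>i\<in>?I. emeasure law (?B i))"
      by (rule P.emeasure_PiM) auto
    also have "\<dots> = ennreal (\<Prod>i\<in>?I. F (x + c * (real (Suc n) - real i) - \<delta>))"
      by (simp add: F_def law.emeasure_eq_measure prod_ennreal)
    \<comment> \<open>Counting the earlier variables backwards by \<open>k = n - i\<close> turns the
      lag \<open>Suc n - i\<close> into \<open>Suc k\<close>.\<close>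
    also have "(\<Prod>i\<in>?I. F (x + c * (real (Suc n) - real i) - \<delta>)) = record_integrand c \<delta> n x"
      unfolding record_integrand_def
      by (rule prod.reindex_bij_witness[where i = "\<lambda>k. n - k" and j = "\<lambda>i. n - i"])
        (auto simp: of_nat_diff algebra_simps)
    finally show "(\<integral>\<^sup>+y. indicator A (y(Suc n := x)) \<partial>(\<Pi>\<^sub>M i\<in>?I. law))
        = ennreal (record_integrand c \<delta> n x)" .
  qed
  also have "\<dots> = ennreal (integral\<^sup>L law (record_integrand c \<delta> n))"
    by (intro nn_integral_eq_integral integrable_record_integrand) auto
  finally show ?thesis
    unfolding record_prob_def measure_def by (simp add: integral_nonneg_AE)
qed

section \<open>Positivity of the limit as a condition at a single point\<close>

lemma asymp_record_prob_pos_iff: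
  "asymp_record_prob M X \<delta> c > 0 \<longleftrightarrow>
    (\<exists>x. x_minus < ereal x \<and> ereal x < x_plus \<and>
      (\<forall>k. 0 < F (x + c * real (Suc k) - \<delta>)) \<and>
      summable (\<lambda>k. 1 - F (x + c * real (Suc k) - \<delta>)))" (is "_ \<longleftrightarrow> (\<exists>x. ?Q x)")
proof
  assume "\<exists>x. ?Q x"
  then obtain x where x: "ereal x < x_plus" and pos: "\<And>k. 0 < F (x + c * real (Suc k) - \<delta>)"
    and sm: "summable (\<lambda>k. 1 - F (x + c * real (Suc k) - \<delta>))" by auto
  obtain e where e: "e > 0" "\<And>n. e \<le> record_integrand c \<delta> n x"
    unfolding record_integrand_def by (rule prod_bounded_below_if_summable[OF pos _ sm]) auto
  \<comment> \<open>Every \<open>y > x\<close> inherits the bound \<open>e\<close> by monotonicity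
    of \<open>F\<close>, and such \<open>y\<close> have positive mass because
    \<open>x < x_plus\<close>. The bound is uniform in \<open>n\<close>, so it passes to the
    limit.\<close>
  have ge: "e * measure law {x<..} \<le> record_prob M X (Suc n) \<delta> c" for n
  proof -
    have int: "integrable law (indicator {x<..} :: real \<Rightarrow> real)"
      by (rule law.integrable_const_bound[where B = 1]) auto
    then have "e * measure law {x<..} = (\<integral>y. e * indicator {x<..} y \<partial>law)"
      by simp
    also have "\<dots> \<le> integral\<^sup>L law (record_integrand c \<delta> n)"
    proof (intro integral_mono integrable_record_integrand)
      fix y
      have "record_integrand c \<delta> n x \<le> record_integrand c \<delta> n y" if "x < y"
        unfolding record_integrand_def using that by (intro prod_mono) (auto intro!: F_mono)
      then show "e * indicator {x<..} y \<le> record_integrand c \<delta> n y"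
        using e(2)[of n] by (auto simp: indicator_def)
    qed (use int in auto)
    finally show ?thesis by (simp add: record_prob_Suc)
  qed
  \<comment> \<open>\<open>lim\<close> is informative only for a convergent sequence, so convergence
    is first derived from monotonicity.\<close>
  have "decseq (\<lambda>n. record_prob M X (Suc n) \<delta> c)"
    unfolding decseq_Suc_iff record_prob_Suc
    by (intro allI integral_mono integrable_record_integrand)
      (auto simp: record_integrand_def intro!: mult_right_le_one_le prod_nonneg)
  then obtain L where L: "(\<lambda>n. record_prob M X (Suc n) \<delta> c) \<longlonglongrightarrow> L"
    using decseq_convergent[of _ "e * measure law {x<..}"] ge by blast
  have "0 < e * measure law {x<..}"
    using e(1) law_greaterThan_pos[OF x] by simp
  also have "\<dots> \<le> L"
    using L ge by (intro LIMSEQ_le_const) auto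
  also have "L = asymp_record_prob M X \<delta> c"
    unfolding asymp_record_prob_def using limI[OF LIMSEQ_imp_Suc[OF L]] by simp
  finally show "asymp_record_prob M X \<delta> c > 0" .
next
  assume pos: "asymp_record_prob M X \<delta> c > 0"
  show "\<exists>x. ?Q x"
  proof (rule ccontr)
    assume none: "\<nexists>x. ?Q x"
    \<comment> \<open>At each point of the support one of the two conditions fails: a divergent
      series drives the product to 0, and a zero factor makes it 0 from then on. Dominated
      convergence with the constant 1 then annihilates the integral.\<close>
    have ptw: "(\<lambda>n. record_integrand c \<delta> n x) \<longlonglongrightarrow> 0"
      if x: "x_minus < ereal x \<and> ereal x < x_plus" for x
    proof (cases "\<forall>k. 0 < F (x + c * real (Suc k) - \<delta>)")
      case True
      then show ?thesis
        using none x unfolding record_integrand_def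
        by (intro prod_tendsto_0_if_not_summable) auto
    next
      case False
      then obtain k where "F (x + c * real (Suc k) - \<delta>) = 0"
        using F_nonneg by (metis order_le_less)
      then have "record_integrand c \<delta> n x = 0" if "n > k" for n
        unfolding record_integrand_def using that by (intro prod_zero) auto
      then show ?thesis
        by (intro tendsto_eventually eventually_sequentiallyI[of "Suc k"]) auto
    qed
    have "(\<lambda>n. integral\<^sup>L law (record_integrand c \<delta> n)) \<longlonglongrightarrow> (\<integral>x. 0 \<partial>law)"
    proof (rule integral_dominated_convergence[where w = "\<lambda>_. 1"])
      show "AE x in law. (\<lambda>n. record_integrand c \<delta> n x) \<longlonglongrightarrow> 0"
        using AE_law_support by (rule eventually_mono) (rule ptw)
    qed auto
    then have "(\<lambda>n. record_prob M X n \<delta> c) \<longlonglongrightarrow> 0"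
      by - (rule LIMSEQ_imp_Suc, simp add: record_prob_Suc)
    then have "asymp_record_prob M X \<delta> c = 0"
      unfolding asymp_record_prob_def by (rule limI)
    with pos show False by simp
  qed
qed

section \<open>Tail sums and the finiteness of \<open>mu_plus f\<close>\<close>

text \<open>As the expectation of the positive part, \<open>mu_plus f\<close> can be compared
  pointwise with a count of lattice points.\<close>

lemma mu_plus_eq: "mu_plus f = (\<integral>\<^sup>+x. ennreal (max 0 x) \<partial>law)"
proof -
  have "ennreal (x * f x) * indicator {0..} x = ennreal (f x) * ennreal (max 0 x)" for x
    using f_nonneg[of x] by (auto simp: indicator_def ennreal_mult'[symmetric] mult.commute max_def)
  then show ?thesis
    unfolding mu_plus_def law_def by (subst nn_integral_density) auto
qed

text \<open>The sum of the tails is the expected number of lattice points \<open>b + c * (k + 1)\<close> below the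
  variable, which differs from its positive part divided by \<open>c\<close> by a bounded amount.\<close>

lemma summable_tail_iff:
  assumes "c > 0"
  shows "summable (\<lambda>k. 1 - F (b + c * real (Suc k))) \<longleftrightarrow> mu_plus f < \<infinity>"
proof -
  \<comment> \<open>\<open>nat\<close> sends negative floors to 0, so \<open>N t\<close> is the
    right count even when \<open>t\<close> lies below all lattice points.\<close>
  define N where "N t = nat \<lfloor>(t - b) / c\<rfloor>" for t
  have count: "(\<Sum>k. indicator {b + c * real (Suc k)..} t) = ennreal (real (N t))" for t
  proof -
    have mem: "b + c * real (Suc k) \<le> t \<longleftrightarrow> k < N t" for k
    proof -
      have "b + c * real (Suc k) \<le> t \<longleftrightarrow> real (Suc k) \<le> (t - b) / c"
        using assms by (simp add: field_simps)
      also have "\<dots> \<longleftrightarrow> int (Suc k) \<le> \<lfloor>(t - b) / c\<rfloor>"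
        by (simp add: le_floor_iff)
      also have "\<dots> \<longleftrightarrow> k < N t"
        unfolding N_def by linarith
      finally show ?thesis .
    qed
    have "(\<Sum>k. indicator {b + c * real (Suc k)..} t :: ennreal)
        = (\<Sum>k<N t. indicator {b + c * real (Suc k)..} t)"
      by (rule suminf_finite) (auto simp: indicator_def mem simp del: of_nat_Suc)
    also have "\<dots> = (\<Sum>k<N t. 1)"
      by (rule sum.cong) (auto simp: indicator_def mem simp del: of_nat_Suc)
    finally show ?thesis by (simp add: ennreal_of_nat_eq_real_of_nat)
  qed
  have [measurable]: "N \<in> measurable borel (count_space UNIV)"
    unfolding N_def by measurable
  \<comment> \<open>Tonelli: each tail is the expectation of one of the indicators summed in
    \<open>count\<close>.\<close>
  have tails: "(\<Sum>k. ennreal (1 - F (b + c * real (Suc k)))) = (\<integral>\<^sup>+t. ennreal (real (N t)) \<partial>law)"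
    unfolding count[symmetric] one_minus_F
    by (subst nn_integral_suminf) (auto simp: law.emeasure_eq_measure)
  \<comment> \<open>Dropping the floor gives the upper estimate.\<close>
  have "N t \<le> (max 0 t + \<bar>b\<bar>) / c" for t
  proof -
    have "N t \<le> max 0 ((t - b) / c)" unfolding N_def by linarith
    also have "\<dots> \<le> (max 0 t + \<bar>b\<bar>) / c" using assms by (simp add: divide_right_mono)
    finally show ?thesis .
  qed
  then have "ennreal (real (N t)) \<le> ennreal (1 / c * max 0 t + \<bar>b\<bar> / c)" for t
    by (intro ennreal_leI) (simp add: add_divide_distrib)
  moreover have "ennreal (1 / c * max 0 t + \<bar>b\<bar> / c)
      = ennreal (1 / c) * ennreal (max 0 t) + ennreal (\<bar>b\<bar> / c)" for t
    using assms by (subst ennreal_plus, simp, simp, subst ennreal_mult) auto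
  ultimately have "(\<integral>\<^sup>+t. ennreal (real (N t)) \<partial>law)
      \<le> (\<integral>\<^sup>+t. ennreal (1 / c) * ennreal (max 0 t) + ennreal (\<bar>b\<bar> / c) \<partial>law)"
    by (intro nn_integral_mono) metis
  also have "\<dots> = ennreal (1 / c) * (\<integral>\<^sup>+t. ennreal (max 0 t) \<partial>law) + ennreal (\<bar>b\<bar> / c)"
    by (subst nn_integral_add, simp, simp, subst nn_integral_cmult)
      (simp_all add: law.emeasure_space_1[simplified])
  finally have upper: "(\<integral>\<^sup>+t. ennreal (real (N t)) \<partial>law) \<le> \<dots>" .
  \<comment> \<open>Conversely, rounding down loses less than 1, which costs one extra
    \<open>c\<close>. The law has total mass 1, so the additive constants stay finite after
    integration and both integrals are finite together.\<close>
  have "max 0 t \<le> c * N t + (c + \<bar>b\<bar>)" for t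
  proof -
    have "(t - b) / c \<le> N t + 1" unfolding N_def by linarith
    then have "t - b \<le> c * N t + c" using assms by (simp add: field_simps)
    then show ?thesis using assms by (simp add: max_def) (smt (verit) mult_nonneg_nonneg of_nat_0_le_iff)
  qed
  then have "ennreal (max 0 t) \<le> ennreal (c * N t + (c + \<bar>b\<bar>))" for t
    by (intro ennreal_leI)
  moreover have "ennreal (c * N t + (c + \<bar>b\<bar>))
      = ennreal c * ennreal (real (N t)) + ennreal (c + \<bar>b\<bar>)" for t
    using assms by (subst ennreal_plus, simp, simp, subst ennreal_mult) auto
  ultimately have "(\<integral>\<^sup>+t. ennreal (max 0 t) \<partial>law)
      \<le> (\<integral>\<^sup>+t. ennreal c * ennreal (real (N t)) + ennreal (c + \<bar>b\<bar>) \<partial>law)"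
    by (intro nn_integral_mono) metis
  also have "\<dots> = ennreal c * (\<integral>\<^sup>+t. ennreal (real (N t)) \<partial>law) + ennreal (c + \<bar>b\<bar>)"
    by (subst nn_integral_add, simp, simp, subst nn_integral_cmult)
      (simp_all add: law.emeasure_space_1[simplified])
  finally have lower: "(\<integral>\<^sup>+t. ennreal (max 0 t) \<partial>law) \<le> \<dots>" .
  have "summable (\<lambda>k. 1 - F (b + c * real (Suc k))) \<longleftrightarrow>
      (\<Sum>k. ennreal (1 - F (b + c * real (Suc k)))) < \<infinity>"
    unfolding infinity_ennreal_def less_top[symmetric]
    by (rule iffI, erule ennreal_suminf_neq_top, simp) (erule summable_suminf_not_top[rotated], simp)
  also have "\<dots> \<longleftrightarrow> mu_plus f < \<infinity>"
    unfolding tails mu_plus_eq infinity_ennreal_def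
  proof
    assume "(\<integral>\<^sup>+t. ennreal (real (N t)) \<partial>law) < top"
    then show "(\<integral>\<^sup>+t. ennreal (max 0 t) \<partial>law) < top"
      by (intro le_less_trans[OF lower]) (simp add: ennreal_mult_less_top)
  next
    assume "(\<integral>\<^sup>+t. ennreal (max 0 t) \<partial>law) < top"
    then show "(\<integral>\<^sup>+t. ennreal (real (N t)) \<partial>law) < top"
      by (intro le_less_trans[OF upper]) (simp add: ennreal_mult_less_top)
  qed
  finally show ?thesis .
qed

text \<open>The arguments of \<open>F\<close> tend to minus infinity, so the terms are eventually at
  least \<open>1 - F u > 0\<close> for a point \<open>u\<close> of the support and cannot tend to
  0.\<close>

lemma not_summable_tail_neg:
  assumes "c < 0"
  shows "\<not> summable (\<lambda>k. 1 - F (b + c * real (Suc k)))"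
proof
  assume "summable (\<lambda>k. 1 - F (b + c * real (Suc k)))"
  then have lim: "(\<lambda>k. 1 - F (b + c * real (Suc k))) \<longlonglongrightarrow> 0"
    by (rule summable_LIMSEQ_zero)
  obtain u where u: "x_minus < ereal u" "ereal u < x_plus"
    using endpoints ereal_dense2 by blast
  have "F u < 1"
    using F_eq_1_iff[of u] F_le_1[of u] u(2) by (metis not_le order_le_less)
  then have "eventually (\<lambda>k. 1 - F (b + c * real (Suc k)) < 1 - F u) sequentially"
    by (intro order_tendstoD(2)[OF lim]) simp
  moreover have "eventually (\<lambda>k. b + c * real (Suc k) \<le> u) sequentially"
  proof (rule eventually_sequentiallyI)
    fix k assume "k \<ge> nat \<lceil>(u - b) / c\<rceil>"
    then have "(u - b) / c \<le> real (Suc k)" by linarith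
    then show "b + c * real (Suc k) \<le> u" using assms by (simp add: field_simps)
  qed
  ultimately have "eventually (\<lambda>_. False) sequentially"
    by eventually_elim (use F_mono in force)
  then show False by simp
qed

text \<open>The positive part is almost surely bounded. For \<open>c = 0\<close> this makes the
  condition on \<open>mu_plus f\<close> automatic.\<close>

lemma mu_plus_finite_if_x_plus_finite:
  assumes "x_plus < \<infinity>"
  shows "mu_plus f < \<infinity>"
proof -
  obtain r where r: "x_plus = ereal r"
    using assms endpoints by (cases x_plus) auto
  have "mu_plus f \<le> (\<integral>\<^sup>+x. ennreal (max 0 r) \<partial>law)"
    unfolding mu_plus_eq
  proof (rule nn_integral_mono_AE)
    show "AE x in law. ennreal (max 0 x) \<le> ennreal (max 0 r)"
      using AE_law_support by eventually_elim (auto simp: r intro!: ennreal_leI)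
  qed
  also have "\<dots> < \<infinity>"
    using law.emeasure_space_1 by simp
  finally show ?thesis .
qed

section \<open>The support condition and the cases by the sign of \<open>c\<close>\<close>

text \<open>The two lower bounds on \<open>x\<close> merge into one maximum, and a real lies
  strictly between two extended reals exactly when they are strictly ordered. As
  \<open>x_minus < x_plus\<close>, the difference is never infinity minus infinity.\<close>

lemma ex_support_shift_iff:
  "(\<exists>x. x_minus < ereal x \<and> ereal x < x_plus \<and> x_minus < ereal (x + c - \<delta>)) \<longleftrightarrow>
    ereal \<delta> < x_plus - x_minus + ereal c" (is "?L \<longleftrightarrow> ?R")
proof -
  have "?L \<longleftrightarrow> (\<exists>x. max x_minus (x_minus + ereal (\<delta> - c)) < ereal x \<and> ereal x < x_plus)"
    by (cases x_minus) (auto simp: algebra_simps)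
  also have "\<dots> \<longleftrightarrow> max x_minus (x_minus + ereal (\<delta> - c)) < x_plus"
    using ereal_dense2 by (meson less_trans)
  also have "\<dots> \<longleftrightarrow> ?R"
    using endpoints by (cases x_minus; cases x_plus) (auto simp: max_def)
  finally show ?thesis .
qed

end

theorem theorem1:
  fixes M :: "'a measure"
    and X :: "nat \<Rightarrow> 'a \<Rightarrow> real"
    and f :: "real \<Rightarrow> real"
    and x_minus x_plus :: ereal
    and c \<delta> :: real
  assumes "linear_drift_model M X f x_minus x_plus"
  shows "asymp_record_prob M X \<delta> c > 0 \<longleftrightarrow>
    mu_plus f < \<infinity> \<and>
    ((c > 0 \<and> ereal \<delta> < x_plus - x_minus + ereal c) \<or>
     (c = 0 \<and> \<delta> < 0 \<and> x_plus < \<infinity>))"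
proof -
  interpret linear_drift_model M X f x_minus x_plus by fact
  have shift: "x + c * real (Suc k) - \<delta> = (x - \<delta>) + c * real (Suc k)" for x k
    by simp
  consider "c < 0" | "c = 0" | "c > 0" by linarith
  then show ?thesis
  proof cases
    case 1
    then show ?thesis
      unfolding asymp_record_prob_pos_iff shift using not_summable_tail_neg by simp
  next
    case 2
    \<comment> \<open>All factors equal \<open>F (x - \<delta>)\<close>, and a constant series is
      summable only if its terms vanish. The value 1 then also gives positivity.\<close>
    have "asymp_record_prob M X \<delta> c > 0 \<longleftrightarrow>
        (\<exists>x. x_minus < ereal x \<and> ereal x < x_plus \<and> x_plus \<le> ereal (x - \<delta>))"
      unfolding asymp_record_prob_pos_iff F_eq_1_iff[symmetric] using 2
      by (auto simp: summable_const_iff)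
    also have "\<dots> \<longleftrightarrow> \<delta> < 0 \<and> x_plus < \<infinity>"
    proof
      assume "\<exists>x. x_minus < ereal x \<and> ereal x < x_plus \<and> x_plus \<le> ereal (x - \<delta>)"
      then show "\<delta> < 0 \<and> x_plus < \<infinity>" by (cases x_plus) auto
    next
      assume *: "\<delta> < 0 \<and> x_plus < \<infinity>"
      then obtain r where r: "x_plus = ereal r"
        using endpoints by (cases x_plus) auto
      \<comment> \<open>Since \<open>\<delta> < 0\<close>, there is room between
        \<open>r + \<delta>\<close> and \<open>r\<close>; any \<open>x\<close> chosen there
        satisfies \<open>r < x - \<delta>\<close>.\<close>
      have "max x_minus (ereal (r + \<delta>)) < x_plus" using * r endpoints by simp
      then obtain x where x: "max x_minus (ereal (r + \<delta>)) < ereal x" "ereal x < x_plus"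
        using ereal_dense2 by blast
      then show "\<exists>x. x_minus < ereal x \<and> ereal x < x_plus \<and> x_plus \<le> ereal (x - \<delta>)"
        using r by (intro exI[of _ x]) auto
    qed
    finally show ?thesis
      using 2 mu_plus_finite_if_x_plus_finite by auto
  next
    case 3
    \<comment> \<open>As \<open>c > 0\<close> and \<open>F\<close> is monotone, the factor with
      \<open>k = 0\<close> is the smallest.\<close>
    have "(\<forall>k. 0 < F (x + c * real (Suc k) - \<delta>)) \<longleftrightarrow> x_minus < ereal (x + c - \<delta>)" for x
    proof
      assume "x_minus < ereal (x + c - \<delta>)"
      then have "0 < F (x + c - \<delta>)" by (simp add: F_pos_iff)
      also have "F (x + c - \<delta>) \<le> F (x + c * real (Suc k) - \<delta>)" for k
        using 3 by (intro F_mono) (simp add: algebra_simps)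
      finally show "\<forall>k. 0 < F (x + c * real (Suc k) - \<delta>)" by blast
    next
      assume "\<forall>k. 0 < F (x + c * real (Suc k) - \<delta>)"
      from this[rule_format, of 0] show "x_minus < ereal (x + c - \<delta>)" by (simp add: F_pos_iff)
    qed
    \<comment> \<open>Summability does not depend on \<open>x\<close>, so the moment condition can
      be pulled out of the existential quantifier.\<close>
    moreover have "summable (\<lambda>k. 1 - F (x + c * real (Suc k) - \<delta>)) \<longleftrightarrow> mu_plus f < \<infinity>" for x
      unfolding shift using 3 by (rule summable_tail_iff)
    ultimately have "asymp_record_prob M X \<delta> c > 0 \<longleftrightarrow> mu_plus f < \<infinity> \<and>
        (\<exists>x. x_minus < ereal x \<and> ereal x < x_plus \<and> x_minus < ereal (x + c - \<delta>))"
      unfolding asymp_record_prob_pos_iff by blast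
    then show ?thesis
      unfolding ex_support_shift_iff using 3 by simp
  qed
qed

end
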